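(* Let $N\ge0$ be an integer and let $a,b,d,e$ be nonzero complex numbers. Put $$U_n(x)=\frac{(aq,\frac{aq}{de})_n}{(\frac{aq}{d},\frac{aq}{e})_n}\;{}_4\phi_3\Bigl({\frac{2xq^{-N}}{b},\,d,\,e,\,q^{-n}\atop\frac{2aqx}{b},\,q^{-N},\,\frac{deq^{-n}}{a}};q\Bigr),$$ $$V_m(x)=\frac{(\frac{aq^{-N+2}}{de},aq^N)_m}{(\frac{aq}{e},\frac{aq}{d})_m}\;{}_4\phi_3\Bigl({\frac{2xq^{-N}}{b},\,\frac{q^{-N+1}}{d},\,\frac{q^{-N+1}}{e},\,q^{-m}\atop\frac{2axq^{-N+2}}{bde},\,q^{-N},\,\frac{q^{-N-m+1}}{a}};q\Bigr).$$ Then, for $0\le n,m\le N$, $$\sum_{k=0}^NU_n(x_k)V_m(x_k)\,r_k=C_n\,\delta_{n,m},$$ where $x_k=\frac12bq^k$, $$r_k=\frac{(\frac{aq}{d},\frac{aq}{e},q^{-N})_k}{(aq,\frac{aq^{2-N}}{de},q)_k}\,q^k\,\frac{(aq,\frac{de}{aq})_N}{(d,e)_N},\qquad C_n=q^{-n}\,\frac{(q,aq,\frac{aq^{2-N}}{de})_n}{(q^{-N},\frac{aq}{d},\frac{aq}{e})_n}.$$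
   Context: Throughout $q\in\mathbb C$, $0<|q|<1$; $(x)_0=1$, $(x)_k=\prod_{j=0}^{k-1}(1-xq^j)$, $(x_1,\dots,x_r)_k=\prod_i (x_i)_k$. The parameter $e$ is a complex number (not Euler's number). $${}_4\phi_3\Bigl({\alpha_1,\alpha_2,\alpha_3,q^{-n}\atop\beta_1,\beta_2,\beta_3};q\Bigr)=\sum_{k=0}^n\frac{(\alpha_1,\alpha_2,\alpha_3,q^{-n})_k}{(\beta_1,\beta_2,\beta_3,q)_k}\,q^k .$$ Standing assumption: parameters are such that no zero denominators occur. *)

theory Defs
  imports Complex_Main
begin

definition qpoch :: "complex \<Rightarrow> complex \<Rightarrow> nat \<Rightarrow> complex" where
  "qpoch q x k = (\<Prod>j<k. 1 - x * q ^ j)"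

definition qpochs :: "complex \<Rightarrow> complex list \<Rightarrow> nat \<Rightarrow> complex" where
  "qpochs q xs k = (\<Prod>x\<leftarrow>xs. qpoch q x k)"

text \<open>
  The terminating series with upper parameters \<open>\<alpha>1, \<alpha>2, \<alpha>3, q powi (- int n)\<close>; the argument \<open>n\<close>
  stands for the fourth upper parameter and fixes the upper summation limit.
\<close>
definition phi43 ::
  "complex \<Rightarrow> complex \<Rightarrow> complex \<Rightarrow> complex \<Rightarrow> nat \<Rightarrow> complex \<Rightarrow> complex \<Rightarrow> complex \<Rightarrow> complex" where
  "phi43 q \<alpha>1 \<alpha>2 \<alpha>3 n \<beta>1 \<beta>2 \<beta>3 =
     (\<Sum>k=0..n. qpochs q [\<alpha>1, \<alpha>2, \<alpha>3, q powi (- int n)] k / qpochs q [\<beta>1, \<beta>2, \<beta>3, q] k * q ^ k)"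

definition U :: "complex \<Rightarrow> nat \<Rightarrow> complex \<Rightarrow> complex \<Rightarrow> complex \<Rightarrow> complex \<Rightarrow> nat \<Rightarrow> complex \<Rightarrow> complex" where
  "U q N a b d e n x =
     qpochs q [a * q, a * q / (d * e)] n / qpochs q [a * q / d, a * q / e] n *
     phi43 q (2 * x * q powi (- int N) / b) d e n
       (2 * a * q * x / b) (q powi (- int N)) (d * e * q powi (- int n) / a)"

definition V :: "complex \<Rightarrow> nat \<Rightarrow> complex \<Rightarrow> complex \<Rightarrow> complex \<Rightarrow> complex \<Rightarrow> nat \<Rightarrow> complex \<Rightarrow> complex" where
  "V q N a b d e m x =
     qpochs q [a * q powi (2 - int N) / (d * e), a * q ^ N] m / qpochs q [a * q / e, a * q / d] m *
     phi43 q (2 * x * q powi (- int N) / b) (q powi (1 - int N) / d) (q powi (1 - int N) / e) m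
       (2 * a * x * q powi (2 - int N) / (b * d * e)) (q powi (- int N))
       (q powi (1 - int N - int m) / a)"

definition node :: "complex \<Rightarrow> complex \<Rightarrow> nat \<Rightarrow> complex" where
  "node q b k = 1 / 2 * b * q ^ k"

definition weight :: "complex \<Rightarrow> nat \<Rightarrow> complex \<Rightarrow> complex \<Rightarrow> complex \<Rightarrow> nat \<Rightarrow> complex" where
  "weight q N a d e k =
     qpochs q [a * q / d, a * q / e, q powi (- int N)] k /
       qpochs q [a * q, a * q powi (2 - int N) / (d * e), q] k * q ^ k *
     (qpochs q [a * q, d * e / (a * q)] N / qpochs q [d, e] N)"

definition norm_const :: "complex \<Rightarrow> nat \<Rightarrow> complex \<Rightarrow> complex \<Rightarrow> complex \<Rightarrow> nat \<Rightarrow> complex" where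
  "norm_const q N a d e n =
     q powi (- int n) *
     (qpochs q [q, a * q, a * q powi (2 - int N) / (d * e)] n /
       qpochs q [q powi (- int N), a * q / d, a * q / e] n)"

text \<open>
  No factor in a denominator of \<open>U n\<close>, \<open>V m\<close> (evaluated at the nodes \<open>x k\<close>), of the weights
  or of the normalisation constants vanishes, for all indices \<open>n, m, k \<le> N\<close>. In the two
  series conditions \<open>j\<close> is the summation index. This excludes all divisions by zero,
  including terms of the form \<open>0/0\<close>; the denominators \<open>a\<close>, \<open>b\<close>, \<open>d\<close>, \<open>e\<close>, \<open>q\<close>
  inside the parameters are nonzero by separate assumptions.
\<close>
definition no_zero_denominators ::
  "complex \<Rightarrow> nat \<Rightarrow> complex \<Rightarrow> complex \<Rightarrow> complex \<Rightarrow> complex \<Rightarrow> bool" where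
  "no_zero_denominators q N a b d e \<longleftrightarrow>
     (\<forall>n\<le>N. qpochs q [a * q / d, a * q / e] n \<noteq> 0) \<and>
     (\<forall>k\<le>N. \<forall>n\<le>N. \<forall>j\<le>n.
        qpochs q [2 * a * q * node q b k / b, q powi (- int N), d * e * q powi (- int n) / a, q] j \<noteq> 0) \<and>
     (\<forall>k\<le>N. \<forall>m\<le>N. \<forall>j\<le>m.
        qpochs q [2 * a * node q b k * q powi (2 - int N) / (b * d * e), q powi (- int N),
                  q powi (1 - int N - int m) / a, q] j \<noteq> 0) \<and>
     (\<forall>k\<le>N. qpochs q [a * q, a * q powi (2 - int N) / (d * e), q] k \<noteq> 0) \<and>
     qpochs q [d, e] N \<noteq> 0 \<and>
     (\<forall>n\<le>N. qpochs q [q powi (- int N), a * q / d, a * q / e] n \<noteq> 0)"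

end

theory Submission
  imports Defs
begin

text \<open>
  In the variables \<open>\<alpha> = aq/d\<close>, \<open>\<beta> = aq/e\<close>, \<open>w = de/(aq)\<close> the terminating q-Saalschuetz sum becomes
  \<open>\<Sum>k. [n,k] (A)_k (B)_k (AByq^k)_(n-k) (y)_(n-k) y^k = (Ay)_n (By)_n\<close>, free of denominators and hence
  valid for all \<open>A\<close>, \<open>B\<close>, \<open>y\<close>, and the weights are proportional to the terms of such a sum with
  \<open>n = N\<close>.  Multiplying the weight by \<open>(\<beta>q^k)_i / (q^(1-N+k)/w)_i\<close> and by a term of \<open>U\<close> keeps it of
  this form, so the sum over the nodes is explicit; the remaining sum defining \<open>U\<close> is again of this
  form and yields a factor \<open>(q^(-i))_n\<close>, which vanishes for \<open>i < n\<close>.  Expanding \<open>V\<close> in these fractions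
  (once more by q-Saalschuetz) leaves a sum over \<open>i\<close>, summed the same way, and a
  q-Chu-Vandermonde sum with value \<open>(1)_(m-n)\<close>.
\<close>

section \<open>q-shifted factorials and q-binomial coefficients\<close>

text \<open>Meant for \<open>k \<le> n\<close> only: for \<open>k > n\<close> truncated subtraction
  yields \<open>(q)_n / (q)_k\<close> instead of 0, so sums with this coefficient stop at
  \<open>n\<close>.\<close>

definition qbin :: "complex \<Rightarrow> nat \<Rightarrow> nat \<Rightarrow> complex" where
  "qbin q n k = qpoch q q n / (qpoch q q k * qpoch q q (n - k))"

lemma qpoch_0 [simp]: "qpoch q x 0 = 1"
  by (simp add: qpoch_def)

lemma qpoch_Suc: "qpoch q x (Suc n) = qpoch q x n * (1 - x * q ^ n)"
  by (simp add: qpoch_def)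

lemma qpoch_add: "qpoch q x (m + n) = qpoch q x m * qpoch q (x * q ^ m) n"
  by (induction n) (simp_all add: qpoch_Suc power_add mult_ac)

lemma qpoch_Suc_left: "qpoch q x (Suc n) = (1 - x) * qpoch q (x * q) n"
  using qpoch_add[of q x 1 n] by (simp add: qpoch_Suc)

lemma qpoch_nonzero_le: "qpoch q x n \<noteq> 0 \<Longrightarrow> k \<le> n \<Longrightarrow> qpoch q x k \<noteq> 0"
  using qpoch_add[of q x k "n - k"] by auto

lemma qpoch_eq_0: "x * q ^ j = 1 \<Longrightarrow> j < n \<Longrightarrow> qpoch q x n = 0"
  unfolding qpoch_def by (rule prod_zero) auto

lemma qpoch_self_nonzero:
  assumes "norm q < 1"
  shows "qpoch q q n \<noteq> 0"
proof -
  have "q * q ^ j \<noteq> 1" for j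
  proof -
    have "norm (q * q ^ j) = norm q ^ Suc j" by (simp add: norm_mult norm_power)
    also have "\<dots> < 1" using assms by (simp add: power_less_one_iff del: power_Suc)
    finally show ?thesis by auto
  qed
  then show ?thesis by (simp add: qpoch_def)
qed

text \<open>The product is read backwards: since \<open>u * v * q^(k-1) = 1\<close>, each factor
  satisfies \<open>1 - v q^i = -v q^i (1 - u q^(k-1-i))\<close>.\<close>

lemma qpoch_reflect:
  assumes "u * v * q ^ k = q" "q \<noteq> 0"
  shows "qpoch q v k = (- v) ^ k * q ^ (\<Sum>j<k. j) * qpoch q u k"
  using assms(1)
proof (induction k arbitrary: u)
  case (Suc k)
  have uv: "u * v * q ^ k = 1" using Suc.prems assms(2) by (simp add: mult.assoc)
  then have IH: "qpoch q v k = (- v) ^ k * q ^ (\<Sum>j<k. j) * qpoch q (u * q) k"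
    by (intro Suc.IH) (metis mult.assoc mult.commute mult.right_neutral)
  have "1 - v * q ^ k = - v * q ^ k * (1 - u)" using uv by (simp add: algebra_simps)
  then show ?case
    by (simp add: qpoch_Suc[of q v] qpoch_Suc_left[of q u] IH power_add)
qed simp

section \<open>The weights and both function families in normalized form\<close>

text \<open>
  In \<open>pole_frac\<close>, \<open>u_basis\<close> and \<open>v_sum\<close>, \<open>k\<close> is the index of the node and must satisfy \<open>k \<le> N\<close>:
  \<open>q ^ (N - k)\<close> stands for \<open>q ^ N\<close> divided by \<open>q ^ k\<close>.
\<close>

definition saal_weight :: "complex \<Rightarrow> nat \<Rightarrow> complex \<Rightarrow> complex \<Rightarrow> complex \<Rightarrow> nat \<Rightarrow> complex" where
  "saal_weight q N \<alpha> \<beta> w k = qbin q N k * qpoch q \<alpha> k * qpoch q \<beta> k *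
     qpoch q (\<alpha> * \<beta> * w * q ^ k) (N - k) * qpoch q w (N - k) * w ^ k"

definition pole_frac :: "complex \<Rightarrow> nat \<Rightarrow> complex \<Rightarrow> complex \<Rightarrow> nat \<Rightarrow> nat \<Rightarrow> complex" where
  "pole_frac q N \<beta> w i k = qpoch q (\<beta> * q ^ k) i / qpoch q (q / (w * q ^ (N - k))) i"

definition u_basis :: "complex \<Rightarrow> nat \<Rightarrow> complex \<Rightarrow> nat \<Rightarrow> nat \<Rightarrow> complex" where
  "u_basis q N c j k = qpoch q (1 / q ^ (N - k)) j / (qpoch q (1 / q ^ N) j * qpoch q (c * q ^ k) j)"

text \<open>This is \<open>U\<close> without the prefactor
  \<open>(aq)_n / (\<alpha>, \<beta>)_n\<close>, where \<open>\<alpha> w = e\<close>,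
  \<open>\<beta> w = d\<close> and \<open>\<alpha> \<beta> w = aq\<close>. The factors
  \<open>(q^(-n))_j\<close> and \<open>(de q^(-n)/a)_j\<close> are absorbed, together with
  \<open>(aq/(de))_n\<close>, into \<open>qbin\<close>, \<open>(1/w)_(n-j)\<close> and the power of
  \<open>1/w\<close>.\<close>

definition u_sum :: "complex \<Rightarrow> nat \<Rightarrow> complex \<Rightarrow> complex \<Rightarrow> complex \<Rightarrow> nat \<Rightarrow> nat \<Rightarrow> complex" where
  "u_sum q N \<alpha> \<beta> w n k = (\<Sum>j\<le>n. qbin q n j * qpoch q (\<alpha> * w) j * qpoch q (\<beta> * w) j *
     qpoch q (1 / w) (n - j) * (1 / w) ^ j * u_basis q N (\<alpha> * \<beta> * w) j k)"

definition v_sum :: "complex \<Rightarrow> nat \<Rightarrow> complex \<Rightarrow> complex \<Rightarrow> complex \<Rightarrow> nat \<Rightarrow> nat \<Rightarrow> complex" where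
  "v_sum q N \<alpha> \<beta> w m k = (let X = \<alpha> * \<beta> * w * q ^ N / q in
     \<Sum>j\<le>m. qbin q m j * qpoch q X (m - j) * X ^ j *
       qpoch q (q / (q ^ N * \<alpha> * w)) j * qpoch q (q / (q ^ N * \<beta> * w)) j * qpoch q (1 / q ^ (N - k)) j /
       (qpoch q (1 / q ^ N) j * qpoch q (q / (w * q ^ (N - k))) j))"

section \<open>Terminating q-summation formulas\<close>

context
  fixes q :: complex
  assumes q0: "q \<noteq> 0" and qq0: "\<And>n. qpoch q q n \<noteq> 0"
begin

lemma qbin_0 [simp]: "qbin q n 0 = 1" and qbin_self [simp]: "qbin q n n = 1"
  using qq0 by (simp_all add: qbin_def)

lemma one_minus_power_nonzero: "1 - q * q ^ n \<noteq> 0"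
  using qq0[of "Suc n"] by (auto simp: qpoch_Suc)

text \<open>Induction on \<open>n\<close>: passing from \<open>n\<close> to \<open>n + 1\<close>
  multiplies the right-hand side by \<open>(1 - a y q^n)(1 - b y q^n)\<close>, and the sum obeys the
  same recurrence because the difference of the two summands telescopes.\<close>

lemma q_saalschuetz:
  "(\<Sum>k\<le>n. qbin q n k * qpoch q a k * qpoch q b k * qpoch q (a * b * y * q ^ k) (n - k) *
      qpoch q y (n - k) * y ^ k) = qpoch q (a * y) n * qpoch q (b * y) n"
proof (induction n)
  case (Suc n)
  define T where "T n k = qbin q n k * qpoch q a k * qpoch q b k *
    qpoch q (a * b * y * q ^ k) (n - k) * qpoch q y (n - k) * y ^ k" for n k
  let ?R = "(1 - a * y * q ^ n) * (1 - b * y * q ^ n)"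
  \<comment> \<open>The telescoped form of the recurrence: the subtracted term is an explicit
    antidifference. At \<open>K = n\<close> it equals \<open>T (Suc n) (Suc n)\<close>, so it
    cancels when the last term is added.\<close>
  have partial: "(\<Sum>k\<le>K. T (Suc n) k) =
      ?R * (\<Sum>k\<le>K. T n k) - q ^ (n - K) * y * (1 - a * q ^ K) * (1 - b * q ^ K) * T n K"
    if "K \<le> n" for K
    using that
  proof (induction K)
    case 0
    show ?case by (simp add: T_def qpoch_Suc algebra_simps)
  next
    case (Suc K)
    then obtain r where n: "n = Suc K + r" using le_Suc_ex by blast
    \<comment> \<open>The common factor of the three neighbouring terms
      \<open>T (Suc n) (Suc K)\<close>, \<open>T n K\<close> and \<open>T n (Suc K)\<close>; their
      cofactors are polynomials, so \<open>key\<close> becomes a polynomial identity.\<close>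
    define A where "A = qpoch q a K * qpoch q b K * qpoch q (a * b * y * q ^ Suc K) r *
      qpoch q y r * y ^ K * qpoch q q n / (qpoch q q (Suc K) * qpoch q q (Suc r))"
    let ?c = "a * b * y"
    have nz: "1 - q * q ^ K \<noteq> 0" "1 - q * q ^ r \<noteq> 0" "qpoch q q K \<noteq> 0" "qpoch q q r \<noteq> 0"
      using one_minus_power_nonzero qq0 by auto
    have T1: "T (Suc n) (Suc K) = A * (1 - a * q ^ K) * (1 - b * q ^ K) * y *
       (1 - ?c * q ^ n) * (1 - y * q ^ r) * (1 - q * q ^ n)"
      using nz unfolding T_def A_def qbin_def n
      by (simp add: qpoch_Suc power_add Suc_diff_le field_simps)
    have T2: "T n K = A * (1 - ?c * q ^ K) * (1 - y * q ^ r) * (1 - q * q ^ K)"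
    proof -
      have "qpoch q (?c * q ^ K) (Suc r) = (1 - ?c * q ^ K) * qpoch q (?c * q ^ Suc K) r"
        by (simp add: qpoch_Suc_left mult_ac)
      then show ?thesis
        using nz unfolding T_def A_def qbin_def n
        by (simp add: qpoch_Suc[of q y] qpoch_Suc[of q q] Suc_diff_le)
    qed
    have T3: "T n (Suc K) = A * (1 - a * q ^ K) * (1 - b * q ^ K) * y * (1 - q * q ^ r)"
      using nz unfolding T_def A_def qbin_def n by (simp add: qpoch_Suc mult_ac)
    have key: "T (Suc n) (Suc K) - q ^ (n - K) * y * (1 - a * q ^ K) * (1 - b * q ^ K) * T n K =
       ?R * T n (Suc K) - q ^ (n - Suc K) * y * (1 - a * q ^ Suc K) * (1 - b * q ^ Suc K) * T n (Suc K)"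
      unfolding T1 T2 T3 unfolding n by (simp add: power_add Suc_diff_le) algebra
    have IH: "(\<Sum>k\<le>K. T (Suc n) k) =
        ?R * (\<Sum>k\<le>K. T n k) - q ^ (n - K) * y * (1 - a * q ^ K) * (1 - b * q ^ K) * T n K"
      using Suc by simp
    have "(\<Sum>k\<le>Suc K. T (Suc n) k) = ?R * (\<Sum>k\<le>K. T n k) +
        (T (Suc n) (Suc K) - q ^ (n - K) * y * (1 - a * q ^ K) * (1 - b * q ^ K) * T n K)"
      by (simp only: sum.atMost_Suc IH) simp
    then show ?case by (simp only: key sum.atMost_Suc distrib_left add_diff_eq)
  qed
  have "(\<Sum>k\<le>Suc n. T (Suc n) k) = ?R * (\<Sum>k\<le>n. T n k)"
    using partial[of n] by (simp add: T_def qpoch_Suc)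
  also have "\<dots> = qpoch q (a * y) (Suc n) * qpoch q (b * y) (Suc n)"
    using Suc.IH by (simp add: T_def qpoch_Suc)
  finally show ?case by (simp only: T_def)
qed simp

lemma q_chu_vandermonde:
  "(\<Sum>k\<le>n. qbin q n k * qpoch q a k * qpoch q y (n - k) * y ^ k) = qpoch q (a * y) n"
proof -
  have "qpoch q 0 k = 1" for k by (simp add: qpoch_def)
  then show ?thesis using q_saalschuetz[of n a 0 y] by simp
qed

section \<open>Reversal identities for negative powers of q\<close>

text \<open>Split \<open>(q)_n\<close> after \<open>n - k\<close> factors and reverse the remaining
  \<open>k\<close>. This turns factors \<open>(q^(-n))_k\<close> into quotients of
  q-factorials.\<close>

lemma qpoch_neg_power:
  assumes "k \<le> n"
  shows "qpoch q q n = (- (q * q ^ (n - k))) ^ k * q ^ (\<Sum>j<k. j) * qpoch q (1 / q ^ n) k * qpoch q q (n - k)"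
proof -
  have "qpoch q (q * q ^ (n - k)) k = (- (q * q ^ (n - k))) ^ k * q ^ (\<Sum>j<k. j) * qpoch q (1 / q ^ n) k"
    by (rule qpoch_reflect) (use q0 assms in \<open>simp_all add: field_simps flip: power_add\<close>)
  then show ?thesis using qpoch_add[of q q "n - k" k] assms by simp
qed

lemma qpoch_neg_power_nonzero: "k \<le> n \<Longrightarrow> qpoch q (1 / q ^ n) k \<noteq> 0"
  using qpoch_neg_power[of k n] qq0[of n] by auto

lemma qpoch_neg_power_eq_0: "n < k \<Longrightarrow> qpoch q (1 / q ^ n) k = 0"
  using q0 by (intro qpoch_eq_0[of _ _ n]) auto

text \<open>Reversing the last \<open>j\<close> factors of both \<open>(y)_n\<close> and
  \<open>(q)_n\<close> produces the same triangular power of \<open>q\<close>, which cancels. It is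
  the bridge from the series notation with \<open>q^(-n)\<close> to the form summed by
  \<open>q_saalschuetz\<close>.\<close>

lemma qbin_reversed:
  assumes "j \<le> n" "y \<noteq> 0" "qpoch q (q / (q ^ n * y)) j \<noteq> 0"
  shows "qpoch q y n * qpoch q (1 / q ^ n) j / (qpoch q (q / (q ^ n * y)) j * qpoch q q j) * q ^ j =
     qbin q n j * qpoch q y (n - j) * y ^ j"
proof -
  obtain r where n: "n = r + j" using assms(1) by (metis le_add_diff_inverse2)
  have "qpoch q (y * q ^ r) j = (- (y * q ^ r)) ^ j * q ^ (\<Sum>j<j. j) * qpoch q (q / (q ^ n * y)) j"
    by (rule qpoch_reflect) (use q0 assms(2) n in \<open>simp_all add: field_simps flip: power_add\<close>)
  then have 1: "qpoch q y n = qpoch q y r * ((- (y * q ^ r)) ^ j * q ^ (\<Sum>j<j. j) * qpoch q (q / (q ^ n * y)) j)"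
    using qpoch_add[of q y r j] n by simp
  have 2: "qpoch q q n = (- (q * q ^ r)) ^ j * q ^ (\<Sum>j<j. j) * qpoch q (1 / q ^ n) j * qpoch q q r"
    using qpoch_neg_power[of j n] n by simp
  have 3: "n - j = r" using n by simp
  have "(- (y * q ^ r)) ^ j * q ^ j = (- (q * q ^ r)) ^ j * y ^ j"
    by (simp add: mult_ac flip: power_mult_distrib)
  then show ?thesis
    using assms(3) qq0[of r] qq0[of j] unfolding qbin_def 1 2 3 by (simp add: divide_simps)
qed

text \<open>After reflecting both factors of length \<open>i\<close>, the two sides are the two ways
  to split \<open>(w/q^i)_(M+i)\<close>. It serves to cancel the denominator of
  \<open>pole_frac\<close> against the factor \<open>(w)_(N-k)\<close> of the weight.\<close>

lemma qpoch_shift_down: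
  assumes "w \<noteq> 0"
  shows "qpoch q w M * qpoch q (q / w) i = q ^ (M * i) * qpoch q (w / q ^ i) M * qpoch q (q / (w * q ^ M)) i"
proof -
  define C where "C = q ^ (\<Sum>j<i. j)"
  have 1: "qpoch q (q / w) i = (- (q / w)) ^ i * C * qpoch q (w / q ^ i) i"
    unfolding C_def by (rule qpoch_reflect) (use q0 assms in \<open>simp_all add: field_simps\<close>)
  have 2: "qpoch q (q / (w * q ^ M)) i = (- (q / (w * q ^ M))) ^ i * C * qpoch q (w / q ^ i * q ^ M) i"
    unfolding C_def by (rule qpoch_reflect) (use q0 assms in \<open>simp_all add: field_simps\<close>)
  have 3: "qpoch q (w / q ^ i) i * qpoch q w M = qpoch q (w / q ^ i) M * qpoch q (w / q ^ i * q ^ M) i"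
    using qpoch_add[of q "w / q ^ i" i M] qpoch_add[of q "w / q ^ i" M i] q0
    by (simp add: add.commute)
  have 4: "q ^ (M * i) * (- (q / (w * q ^ M))) ^ i = (- (q / w)) ^ i"
    using q0 by (simp add: power_mult flip: power_mult_distrib)
  have "qpoch q w M * qpoch q (q / w) i = (- (q / w)) ^ i * C * (qpoch q (w / q ^ i) i * qpoch q w M)"
    unfolding 1 by (simp only: mult_ac)
  also have "\<dots> = (q ^ (M * i) * (- (q / (w * q ^ M))) ^ i) * C * (qpoch q (w / q ^ i) M * qpoch q (w / q ^ i * q ^ M) i)"
    unfolding 3 4 ..
  also have "\<dots> = q ^ (M * i) * qpoch q (w / q ^ i) M * qpoch q (q / (w * q ^ M)) i"
    unfolding 2 by (simp only: mult_ac)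
  finally show ?thesis .
qed

lemma qbin_mult_qbin:
  assumes "k \<le> j" "j \<le> n"
  shows "qbin q n j * qbin q j k = qbin q n k * qbin q (n - k) (j - k)"
  using assms qq0 by (simp add: qbin_def)

text \<open>Up to a monomial, \<open>(q^(-(n+l)))_n\<close> is \<open>(q)_(n+l) / (q)_l\<close>, so
  both sides reduce to the same quotient of q-factorials. It is used after shifting a summation
  index by \<open>n\<close>.\<close>

lemma qbin_mult_neg_power:
  assumes "n + l \<le> j"
  shows "qbin q j (n + l) * qpoch q (1 / q ^ (n + l)) n * q ^ (n * l) =
     qbin q j n * qbin q (j - n) l * qpoch q (1 / q ^ n) n"
proof -
  have 1: "qpoch q q (n + l) = (- (q * q ^ l)) ^ n * q ^ (\<Sum>j<n. j) * qpoch q (1 / q ^ (n + l)) n * qpoch q q l"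
    using qpoch_neg_power[of n "n + l"] by simp
  have 2: "qpoch q q n = (- q) ^ n * q ^ (\<Sum>j<n. j) * qpoch q (1 / q ^ n) n"
    using qpoch_neg_power[of n n] by simp
  have 3: "(- (q * q ^ l)) ^ n = (- q) ^ n * q ^ (n * l)"
    by (simp add: power_mult mult.commute[of n] flip: power_mult_distrib)
  have "qbin q j (n + l) * qpoch q q (n + l) * qpoch q q n = qbin q j n * qbin q (j - n) l * qpoch q q n * qpoch q q n * qpoch q q l"
    using assms qq0 by (simp add: qbin_def)
  then have "qbin q j (n + l) * qpoch q (1 / q ^ (n + l)) n * q ^ (n * l) * ((- q) ^ n * q ^ (\<Sum>j<n. j) * qpoch q q n * qpoch q q l) =
     qbin q j n * qbin q (j - n) l * qpoch q (1 / q ^ n) n * ((- q) ^ n * q ^ (\<Sum>j<n. j) * qpoch q q n * qpoch q q l)"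
    unfolding 1 3 by (subst (asm) (3) 2) (simp add: mult_ac)
  then show ?thesis using qq0 q0 by simp
qed

text \<open>With \<open>N = j + k + s\<close> this says that the quotient
  \<open>(q^(-(N-k)))_j / (q^(-N))_j\<close> from \<open>u_basis\<close> lowers the q-binomial
  coefficient from order \<open>N\<close> to order \<open>N - j\<close>, at the cost of
  \<open>q^(k j)\<close>.\<close>

lemma qbin_mult_shifted_neg_power:
  "qbin q (j + k + s) k * qpoch q (1 / q ^ (j + s)) j =
     q ^ (k * j) * qbin q (k + s) k * qpoch q (1 / q ^ (j + k + s)) j"
proof -
  define C where "C = q ^ (\<Sum>i<j. i)"
  have 1: "qpoch q q (j + s) = (- (q * q ^ s)) ^ j * C * qpoch q (1 / q ^ (j + s)) j * qpoch q q s"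
    using qpoch_neg_power[of j "j + s"] by (simp add: C_def)
  have 2: "qpoch q q (j + k + s) = (- (q * q ^ s)) ^ j * q ^ (k * j) * C * qpoch q (1 / q ^ (j + k + s)) j * qpoch q q (k + s)"
  proof -
    have "- (q * q ^ (k + s)) = - (q * q ^ s) * q ^ k" by (simp add: power_add mult_ac)
    then have "(- (q * q ^ (k + s))) ^ j = (- (q * q ^ s)) ^ j * q ^ (k * j)"
      by (simp only: power_mult_distrib power_mult)
    then show ?thesis
      using qpoch_neg_power[of j "j + k + s"] by (simp add: C_def add.assoc)
  qed
  have 3: "qbin q (j + k + s) k * qpoch q q k * qpoch q q (j + s) = qpoch q q (j + k + s)"
    "qbin q (k + s) k * qpoch q q k * qpoch q q s = qpoch q q (k + s)"
    using qq0 by (simp_all add: qbin_def)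
  have "(qbin q (j + k + s) k * qpoch q (1 / q ^ (j + s)) j) * ((- (q * q ^ s)) ^ j * C * qpoch q q s * qpoch q q k) =
     (q ^ (k * j) * qbin q (k + s) k * qpoch q (1 / q ^ (j + k + s)) j) * ((- (q * q ^ s)) ^ j * C * qpoch q q s * qpoch q q k)"
    using 3(1) unfolding 1 2 3(2)[symmetric] by (simp add: mult_ac)
  then show ?thesis using q0 qq0 by (simp add: C_def)
qed

section \<open>Explicit sums over the nodes\<close>

text \<open>The two extra factors change the q-Saalschuetz term of order \<open>N\<close> with
  parameters \<open>\<alpha>\<close>, \<open>\<beta>\<close>, \<open>w\<close> into one of order
  \<open>N - j\<close> with parameters \<open>\<alpha>\<close>, \<open>\<beta> q^i\<close>,
  \<open>w q^(j-i)\<close>, times a factor independent of \<open>k\<close>.\<close>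

lemma sum_over_nodes:
  assumes "j \<le> N" "w \<noteq> 0"
    and nzw: "\<And>k. k \<le> N \<Longrightarrow> qpoch q (q / (w * q ^ (N - k))) i \<noteq> 0"
    and nzc: "\<And>k. k \<le> N \<Longrightarrow> qpoch q (\<alpha> * \<beta> * w * q ^ k) j \<noteq> 0"
  shows "(\<Sum>k\<le>N. saal_weight q N \<alpha> \<beta> w k * pole_frac q N \<beta> w i k * u_basis q N (\<alpha> * \<beta> * w) j k) =
    qpoch q \<beta> i * q ^ (N * i) / qpoch q (q / w) i * qpoch q (w / q ^ i) j *
    qpoch q (\<alpha> * w * q ^ j / q ^ i) (N - j) * qpoch q (\<beta> * w * q ^ j) (N - j)"
proof -
  define y where "y = w * q ^ j / q ^ i"
  define K where "K = qpoch q \<beta> i * q ^ (N * i) / qpoch q (q / w) i * qpoch q (w / q ^ i) j"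
  have summand: "saal_weight q N \<alpha> \<beta> w k * pole_frac q N \<beta> w i k * u_basis q N (\<alpha> * \<beta> * w) j k =
     K * (qbin q (N - j) k * qpoch q \<alpha> k * qpoch q (\<beta> * q ^ i) k *
       qpoch q (\<alpha> * (\<beta> * q ^ i) * y * q ^ k) (N - j - k) * qpoch q y (N - j - k) * y ^ k)"
    if k: "k \<le> N - j" for k
  proof -
    obtain s where N: "N = j + k + s" using k assms(1) by (metis add.assoc le_Suc_ex ordered_cancel_comm_monoid_diff_class.add_diff_inverse)
    \<comment> \<open>The node \<open>k = N\<close> of the hypothesis supplies
      \<open>(q/w)_i \<noteq> 0\<close>.\<close>
    have nz: "qpoch q (q / (w * q ^ (j + s))) i \<noteq> 0" "qpoch q (q / w) i \<noteq> 0"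
      "qpoch q (\<alpha> * \<beta> * w * q ^ k) j \<noteq> 0" "qpoch q (1 / q ^ N) j \<noteq> 0"
      using nzw[of k] nzw[of N] nzc[of k] qpoch_neg_power_nonzero[of j N] by (auto simp: N)
    have 1: "qpoch q \<beta> k * qpoch q (\<beta> * q ^ k) i = qpoch q \<beta> i * qpoch q (\<beta> * q ^ i) k"
      using qpoch_add[of q \<beta> k i] qpoch_add[of q \<beta> i k] by (simp add: add.commute)
    have 2: "qpoch q w (j + s) * qpoch q (q / w) i =
        q ^ ((j + s) * i) * (qpoch q (w / q ^ i) j * qpoch q y s) * qpoch q (q / (w * q ^ (j + s))) i"
      using qpoch_shift_down[OF assms(2), of "j + s" i] qpoch_add[of q "w / q ^ i" j s]
      by (simp add: y_def)
    have 3: "qpoch q (\<alpha> * \<beta> * w * q ^ k) (j + s) =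
        qpoch q (\<alpha> * \<beta> * w * q ^ k) j * qpoch q (\<alpha> * (\<beta> * q ^ i) * y * q ^ k) s"
      using q0 by (simp add: qpoch_add y_def mult_ac)
    \<comment> \<open>The powers of \<open>q\<close> released by the shift and by the lowered
      q-binomial turn \<open>w^k\<close> into \<open>y^k\<close> and leave \<open>q^(N i)\<close>,
      which does not depend on the node.\<close>
    have 4: "w ^ k * q ^ ((j + s) * i) * q ^ (k * j) = q ^ (N * i) * y ^ k"
    proof -
      have "(q ^ i) ^ k = q ^ (k * i)" by (simp add: power_mult mult.commute flip: power_mult)
      then show ?thesis using q0 unfolding y_def N
        by (simp add: power_mult_distrib power_divide add_mult_distrib power_add mult_ac power_mult)
    qed
    have "saal_weight q N \<alpha> \<beta> w k * pole_frac q N \<beta> w i k * u_basis q N (\<alpha> * \<beta> * w) j k =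
      (qbin q (j + k + s) k * qpoch q (1 / q ^ (j + s)) j) * qpoch q \<alpha> k * (qpoch q \<beta> k * qpoch q (\<beta> * q ^ k) i) *
      qpoch q (\<alpha> * \<beta> * w * q ^ k) (j + s) * (qpoch q w (j + s) * qpoch q (q / w) i) * w ^ k /
      (qpoch q (q / w) i * qpoch q (q / (w * q ^ (j + s))) i * (qpoch q (1 / q ^ N) j * qpoch q (\<alpha> * \<beta> * w * q ^ k) j))"
      using nz by (simp add: saal_weight_def pole_frac_def u_basis_def N mult_ac)
    also have "\<dots> = qpoch q \<beta> i / qpoch q (q / w) i * qpoch q (w / q ^ i) j * (w ^ k * q ^ ((j + s) * i) * q ^ (k * j)) *
      (qbin q (k + s) k * qpoch q \<alpha> k * qpoch q (\<beta> * q ^ i) k *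
       qpoch q (\<alpha> * (\<beta> * q ^ i) * y * q ^ k) s * qpoch q y s)"
      unfolding 1 2 3 qbin_mult_shifted_neg_power using nz by (simp add: N[symmetric] mult_ac)
    also have "\<dots> = K * (qbin q (k + s) k * qpoch q \<alpha> k * qpoch q (\<beta> * q ^ i) k *
       qpoch q (\<alpha> * (\<beta> * q ^ i) * y * q ^ k) s * qpoch q y s * y ^ k)"
      unfolding 4 K_def by (simp add: mult_ac)
    finally show ?thesis by (simp add: N)
  qed
  \<comment> \<open>For \<open>k > N - j\<close> the factor \<open>(q^(-(N-k)))_j\<close> of
    \<open>u_basis\<close> vanishes.\<close>
  have "(\<Sum>k\<le>N. saal_weight q N \<alpha> \<beta> w k * pole_frac q N \<beta> w i k * u_basis q N (\<alpha> * \<beta> * w) j k) =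
      (\<Sum>k\<le>N - j. saal_weight q N \<alpha> \<beta> w k * pole_frac q N \<beta> w i k * u_basis q N (\<alpha> * \<beta> * w) j k)"
    by (rule sum.mono_neutral_right)
       (use assms(1) in \<open>auto simp: u_basis_def intro!: qpoch_neg_power_eq_0\<close>)
  also have "\<dots> = K * (qpoch q (\<alpha> * y) (N - j) * qpoch q (\<beta> * q ^ i * y) (N - j))"
    unfolding q_saalschuetz[symmetric] sum_distrib_left by (rule sum.cong) (use summand in auto)
  also have "\<beta> * q ^ i * y = \<beta> * w * q ^ j"
    using q0 by (simp add: y_def)
  finally show ?thesis by (simp add: K_def y_def mult_ac)
qed

text \<open>Sum over the nodes first. What remains over \<open>j\<close> is q-Saalschuetz of order
  \<open>n\<close> with parameters \<open>\<alpha> w\<close>, \<open>w/q^i\<close>,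
  \<open>1/w\<close>, whose value is \<open>(\<alpha>)_n (q^(-i))_n\<close>.\<close>

lemma pairing_pole_frac:
  assumes "n \<le> N" "w \<noteq> 0"
    and nzw: "\<And>k. k \<le> N \<Longrightarrow> qpoch q (q / (w * q ^ (N - k))) i \<noteq> 0"
    and nzc: "\<And>k. k \<le> N \<Longrightarrow> qpoch q (\<alpha> * \<beta> * w * q ^ k) n \<noteq> 0"
  shows "(\<Sum>k\<le>N. saal_weight q N \<alpha> \<beta> w k * u_sum q N \<alpha> \<beta> w n k * pole_frac q N \<beta> w i k) =
    qpoch q (\<beta> * w) N * qpoch q \<alpha> n * (qpoch q \<beta> i * q ^ (N * i) / qpoch q (q / w) i *
    qpoch q (\<alpha> * w * q ^ n / q ^ i) (N - n) * qpoch q (1 / q ^ i) n)"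
proof -
  define K where "K = qpoch q \<beta> i * q ^ (N * i) / qpoch q (q / w) i"
  have "(\<Sum>k\<le>N. saal_weight q N \<alpha> \<beta> w k * u_sum q N \<alpha> \<beta> w n k * pole_frac q N \<beta> w i k) =
     (\<Sum>k\<le>N. \<Sum>j\<le>n. qbin q n j * qpoch q (\<alpha> * w) j * qpoch q (\<beta> * w) j *
     qpoch q (1 / w) (n - j) * (1 / w) ^ j * (saal_weight q N \<alpha> \<beta> w k * pole_frac q N \<beta> w i k * u_basis q N (\<alpha> * \<beta> * w) j k))"
    unfolding u_sum_def sum_distrib_left sum_distrib_right by (intro sum.cong refl) (simp add: mult_ac)
  also have "\<dots> = (\<Sum>j\<le>n. qbin q n j * qpoch q (\<alpha> * w) j * qpoch q (\<beta> * w) j *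
     qpoch q (1 / w) (n - j) * (1 / w) ^ j * (\<Sum>k\<le>N. saal_weight q N \<alpha> \<beta> w k * pole_frac q N \<beta> w i k * u_basis q N (\<alpha> * \<beta> * w) j k))"
    unfolding sum_distrib_left by (rule sum.swap)
  also have "\<dots> = (\<Sum>j\<le>n. K * qpoch q (\<beta> * w) N * qpoch q (\<alpha> * w * q ^ n / q ^ i) (N - n) *
     (qbin q n j * qpoch q (\<alpha> * w) j * qpoch q (w / q ^ i) j *
     qpoch q (\<alpha> * w * (w / q ^ i) * (1 / w) * q ^ j) (n - j) * qpoch q (1 / w) (n - j) * (1 / w) ^ j))"
  proof (intro sum.cong refl)
    fix j assume "j \<in> {..n}"
    then have j: "j \<le> n" by simp
    have 1: "qpoch q (\<beta> * w) j * qpoch q (\<beta> * w * q ^ j) (N - j) = qpoch q (\<beta> * w) N"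
      using qpoch_add[of q "\<beta> * w" j "N - j"] j assms(1) by simp
    \<comment> \<open>Cutting after \<open>n - j\<close> factors isolates a tail that is the same
      for all \<open>j\<close> and can leave the sum.\<close>
    have 2: "qpoch q (\<alpha> * w * q ^ j / q ^ i) (N - j) =
        qpoch q (\<alpha> * w * (w / q ^ i) * (1 / w) * q ^ j) (n - j) * qpoch q (\<alpha> * w * q ^ n / q ^ i) (N - n)"
      using qpoch_add[of q "\<alpha> * w * q ^ j / q ^ i" "n - j" "N - n"] j assms(1,2)
      by (simp add: mult.assoc flip: power_add)
    have 3: "(\<Sum>k\<le>N. saal_weight q N \<alpha> \<beta> w k * pole_frac q N \<beta> w i k * u_basis q N (\<alpha> * \<beta> * w) j k) =
      K * qpoch q (w / q ^ i) j * qpoch q (\<alpha> * w * q ^ j / q ^ i) (N - j) * qpoch q (\<beta> * w * q ^ j) (N - j)"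
      unfolding K_def using j assms by (intro sum_over_nodes) (auto dest: qpoch_nonzero_le[OF nzc])
    show "qbin q n j * qpoch q (\<alpha> * w) j * qpoch q (\<beta> * w) j *
     qpoch q (1 / w) (n - j) * (1 / w) ^ j * (\<Sum>k\<le>N. saal_weight q N \<alpha> \<beta> w k * pole_frac q N \<beta> w i k * u_basis q N (\<alpha> * \<beta> * w) j k) =
      K * qpoch q (\<beta> * w) N * qpoch q (\<alpha> * w * q ^ n / q ^ i) (N - n) *
     (qbin q n j * qpoch q (\<alpha> * w) j * qpoch q (w / q ^ i) j *
     qpoch q (\<alpha> * w * (w / q ^ i) * (1 / w) * q ^ j) (n - j) * qpoch q (1 / w) (n - j) * (1 / w) ^ j)"
      unfolding 3 2 1[symmetric] by (simp only: mult_ac)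
  qed
  also have "\<dots> = K * qpoch q (\<beta> * w) N * qpoch q (\<alpha> * w * q ^ n / q ^ i) (N - n) * (qpoch q \<alpha> n * qpoch q (1 / q ^ i) n)"
    unfolding sum_distrib_left[symmetric] q_saalschuetz using assms(2) by simp
  finally show ?thesis by (simp add: K_def mult_ac)
qed

section \<open>Expansion of V in the fractions\<close>

text \<open>This is q-Saalschuetz with parameters \<open>q/w\<close>, \<open>\<beta> q^k\<close>,
  \<open>1/(q^N \<beta>)\<close>, divided by \<open>(Z)_j\<close>. The choice of the third parameter
  makes the product of all three equal to \<open>Z\<close>, so
  \<open>(Z q^i)_(j-i) / (Z)_j = 1/(Z)_i\<close>, and the node enters only through
  \<open>pole_frac\<close>.\<close>

lemma pole_frac_expansion:
  assumes "k \<le> N" "w \<noteq> 0" "\<beta> \<noteq> 0" "qpoch q (q / (w * q ^ (N - k))) j \<noteq> 0"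
  shows "qpoch q (q / (q ^ N * \<beta> * w)) j * qpoch q (1 / q ^ (N - k)) j / qpoch q (q / (w * q ^ (N - k))) j =
    (\<Sum>i\<le>j. qbin q j i * qpoch q (q / w) i * pole_frac q N \<beta> w i k * qpoch q (1 / (q ^ N * \<beta>)) (j - i) * (1 / (q ^ N * \<beta>)) ^ i)"
proof -
  define Z where "Z = q / (w * q ^ (N - k))"
  have N: "q ^ N = q ^ k * q ^ (N - k)" using assms(1) by (simp flip: power_add)
  have eqs: "q / w * (\<beta> * q ^ k) * (1 / (q ^ N * \<beta>)) = Z" "q / w * (1 / (q ^ N * \<beta>)) = q / (q ^ N * \<beta> * w)"
    "\<beta> * q ^ k * (1 / (q ^ N * \<beta>)) = 1 / q ^ (N - k)"
    using q0 assms by (simp_all add: Z_def N)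
  have "qpoch q (q / (q ^ N * \<beta> * w)) j * qpoch q (1 / q ^ (N - k)) j / qpoch q Z j =
     (\<Sum>i\<le>j. qbin q j i * qpoch q (q / w) i * qpoch q (\<beta> * q ^ k) i * qpoch q (Z * q ^ i) (j - i) *
       qpoch q (1 / (q ^ N * \<beta>)) (j - i) * (1 / (q ^ N * \<beta>)) ^ i / qpoch q Z j)"
    using q_saalschuetz[of j "q / w" "\<beta> * q ^ k" "1 / (q ^ N * \<beta>)"] unfolding eqs sum_divide_distrib[symmetric] by simp
  also have "\<dots> = (\<Sum>i\<le>j. qbin q j i * qpoch q (q / w) i * pole_frac q N \<beta> w i k * qpoch q (1 / (q ^ N * \<beta>)) (j - i) * (1 / (q ^ N * \<beta>)) ^ i)"
  proof (intro sum.cong refl)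
    fix i assume "i \<in> {..j}"
    then have "qpoch q Z j = qpoch q Z i * qpoch q (Z * q ^ i) (j - i)"
      using qpoch_add[of q Z i "j - i"] by simp
    moreover have "qpoch q Z j \<noteq> 0" using assms(4) by (simp add: Z_def)
    ultimately show "qbin q j i * qpoch q (q / w) i * qpoch q (\<beta> * q ^ k) i * qpoch q (Z * q ^ i) (j - i) *
       qpoch q (1 / (q ^ N * \<beta>)) (j - i) * (1 / (q ^ N * \<beta>)) ^ i / qpoch q Z j =
       qbin q j i * qpoch q (q / w) i * pole_frac q N \<beta> w i k * qpoch q (1 / (q ^ N * \<beta>)) (j - i) * (1 / (q ^ N * \<beta>)) ^ i"
      by (simp add: pole_frac_def Z_def[symmetric] field_simps)
  qed
  finally show ?thesis by (simp add: Z_def)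
qed

text \<open>The factor \<open>(q^(-i))_n\<close> kills \<open>i < n\<close>. With
  \<open>i = n + l\<close> the rest is q-Saalschuetz of order \<open>j - n\<close> with parameters
  \<open>\<beta> q^n\<close>, \<open>q/x\<close>, \<open>1/(q^N \<beta>)\<close>. In the application
  \<open>x = \<alpha> w\<close>.\<close>

lemma expansion_coeff_sum:
  assumes "n \<le> j" "j \<le> N" "x \<noteq> 0" "\<beta> \<noteq> 0"
  shows "qpoch q (q / (q ^ N * x)) j * (\<Sum>i\<le>j. qbin q j i * (qpoch q \<beta> i * q ^ (N * i) *
      qpoch q (x * q ^ n / q ^ i) (N - n) * qpoch q (1 / q ^ i) n) *
      qpoch q (1 / (q ^ N * \<beta>)) (j - i) * (1 / (q ^ N * \<beta>)) ^ i) =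
    (1 / \<beta>) ^ n * qpoch q x (N - n) * qpoch q (1 / q ^ n) n * qpoch q \<beta> n * qpoch q (q / (q ^ N * x)) n *
    (qbin q j n * qpoch q (q / (q ^ N * \<beta> * x)) (j - n) * qpoch q (q ^ n / q ^ N) (j - n))"
proof -
  define y where "y = 1 / (q ^ N * \<beta>)"
  define J where "J = j - n"
  define g where "g i = qbin q j i * (qpoch q \<beta> i * q ^ (N * i) *
      qpoch q (x * q ^ n / q ^ i) (N - n) * qpoch q (1 / q ^ i) n) * qpoch q y (j - i) * y ^ i" for i
  define B where "B = qpoch q (q / (q ^ N * x)) n"
  define K where "K = (1 / \<beta>) ^ n * qpoch q x (N - n) * qpoch q (1 / q ^ n) n * qpoch q \<beta> n * B * qbin q j n"
  have j: "j = n + J" using assms(1) by (simp add: J_def)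
  have N: "q ^ N = q ^ n * q ^ (N - n)" using assms(1,2) by (simp flip: power_add)
  have summand: "qpoch q (q / (q ^ N * x)) j * g (n + l) =
     K * (qbin q J l * qpoch q (\<beta> * q ^ n) l * qpoch q (q / x) l *
       qpoch q (\<beta> * q ^ n * (q / x) * y * q ^ l) (J - l) * qpoch q y (J - l) * y ^ l)"
    if l: "l \<le> J" for l
  proof -
    define Q where "Q = \<beta> * q ^ n * (q / x) * y"
    \<comment> \<open>The first form fits \<open>qpoch_shift_down\<close> with
      \<open>M = N - n\<close>; the second continues \<open>(q/(q^N x))_n\<close> to length
      \<open>j\<close>.\<close>
    have Q: "Q = q / (x * q ^ (N - n))" "Q = q / (q ^ N * x) * q ^ n"
      using q0 assms(4) by (simp_all add: Q_def y_def N)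
    have 1: "qpoch q (q / (q ^ N * x)) j = B * (qpoch q Q l * qpoch q (Q * q ^ l) (J - l))"
      using qpoch_add[of q "q / (q ^ N * x)" n J] qpoch_add[of q Q l "J - l"] l
      by (simp add: j B_def Q(2))
    have 2: "q ^ ((N - n) * l) * qpoch q (x / q ^ l) (N - n) * qpoch q Q l = qpoch q x (N - n) * qpoch q (q / x) l"
      using qpoch_shift_down[OF assms(3), of "N - n" l] by (simp add: Q(1))
    have 3: "qbin q j (n + l) * qpoch q (1 / q ^ (n + l)) n * q ^ (n * l) =
        qbin q j n * qbin q J l * qpoch q (1 / q ^ n) n"
      using qbin_mult_neg_power[of n l j] l by (simp add: j)
    \<comment> \<open>Splits off exactly the powers of \<open>q\<close> that facts 2 and 3
      consume.\<close>
    have 4: "q ^ (N * (n + l)) * y ^ (n + l) = (1 / \<beta>) ^ n * (q ^ ((N - n) * l) * q ^ (n * l)) * y ^ l"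
    proof -
      have "q ^ (N * n) * y ^ n = (1 / \<beta>) ^ n"
        using q0 by (simp add: y_def power_mult flip: power_mult_distrib)
      moreover have "q ^ (N * l) = q ^ ((N - n) * l) * q ^ (n * l)"
        unfolding power_mult N power_mult_distrib by (rule mult.commute)
      ultimately show ?thesis by (simp add: power_add distrib_left)
    qed
    have 5: "x * q ^ n / q ^ (n + l) = x / q ^ l" "j - (n + l) = J - l"
      using q0 by (simp_all add: power_add j)
    have "qpoch q (q / (q ^ N * x)) j * g (n + l) =
       B * qpoch q (Q * q ^ l) (J - l) * qpoch q \<beta> (n + l) * qpoch q y (J - l) *
       (qbin q j (n + l) * qpoch q (1 / q ^ (n + l)) n) * (qpoch q (x / q ^ l) (N - n) * qpoch q Q l) *
       (q ^ (N * (n + l)) * y ^ (n + l))"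
      unfolding g_def 5 1 by (simp only: mult_ac)
    also have "\<dots> = B * qpoch q (Q * q ^ l) (J - l) * qpoch q \<beta> (n + l) * qpoch q y (J - l) * (1 / \<beta>) ^ n * y ^ l *
       (qbin q j (n + l) * qpoch q (1 / q ^ (n + l)) n * q ^ (n * l)) *
       (q ^ ((N - n) * l) * qpoch q (x / q ^ l) (N - n) * qpoch q Q l)"
      unfolding 4 by (simp only: mult_ac)
    also have "\<dots> = K * (qbin q J l * qpoch q (\<beta> * q ^ n) l * qpoch q (q / x) l *
       qpoch q (Q * q ^ l) (J - l) * qpoch q y (J - l) * y ^ l)"
      unfolding 2 3 K_def qpoch_add by (simp only: mult_ac)
    finally show ?thesis by (simp only: Q_def)
  qed
  have "(\<Sum>i\<le>j. g i) = (\<Sum>i\<in>{n..j}. g i)"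
    by (rule sum.mono_neutral_right) (auto simp: g_def intro!: qpoch_neg_power_eq_0)
  also have "\<dots> = (\<Sum>l\<le>J. g (n + l))"
    using sum.shift_bounds_cl_nat_ivl[of g 0 n J] by (simp add: j atMost_atLeast0 add.commute)
  finally have "qpoch q (q / (q ^ N * x)) j * (\<Sum>i\<le>j. g i) =
      (\<Sum>l\<le>J. qpoch q (q / (q ^ N * x)) j * g (n + l))"
    by (simp only: sum_distrib_left)
  also have "\<dots> = K * (qpoch q (\<beta> * q ^ n * y) J * qpoch q (q / x * y) J)"
    unfolding q_saalschuetz[symmetric] sum_distrib_left by (intro sum.cong refl summand) simp
  also have "\<beta> * q ^ n * y = q ^ n / q ^ N" using assms(4) by (simp add: y_def)
  also have "q / x * y = q / (q ^ N * \<beta> * x)" by (simp add: y_def mult_ac)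
  finally show ?thesis by (simp add: g_def y_def K_def B_def J_def mult_ac)
qed

section \<open>Biorthogonality in normalized form\<close>

text \<open>Expanding \<open>v_sum\<close> in the fractions and pairing each with
  \<open>u_sum\<close> leaves a double sum over \<open>i \<le> j \<le> m\<close>. The inner sum
  vanishes for \<open>j < n\<close> and is a product otherwise; the outer one is then
  q-Chu-Vandermonde with parameters \<open>1/X\<close> and \<open>X\<close>.\<close>

lemma pairing_u_sum_v_sum:
  assumes "n \<le> N" "m \<le> N" "w \<noteq> 0" "\<alpha> \<noteq> 0" "\<beta> \<noteq> 0"
    and nzw: "\<And>k. k \<le> N \<Longrightarrow> qpoch q (q / (w * q ^ (N - k))) m \<noteq> 0"
    and nzc: "\<And>k. k \<le> N \<Longrightarrow> qpoch q (\<alpha> * \<beta> * w * q ^ k) n \<noteq> 0"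
  shows "(\<Sum>k\<le>N. saal_weight q N \<alpha> \<beta> w k * u_sum q N \<alpha> \<beta> w n k * v_sum q N \<alpha> \<beta> w m k) =
    (if n = m then qpoch q (\<beta> * w) N * qpoch q \<alpha> n * qpoch q \<beta> n * (\<alpha> * w * q ^ N / q) ^ n *
       qpoch q (\<alpha> * w) (N - n) * qpoch q (q / (q ^ N * (\<alpha> * w))) n * qpoch q (1 / q ^ n) n / qpoch q (1 / q ^ N) n
     else 0)"
proof -
  define X where "X = \<alpha> * \<beta> * w * q ^ N / q"
  define y where "y = 1 / (q ^ N * \<beta>)"
  define x where "x = \<alpha> * w"
  define h where "h i = qpoch q \<beta> i * q ^ (N * i) *
      qpoch q (x * q ^ n / q ^ i) (N - n) * qpoch q (1 / q ^ i) n" for i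
  define t where "t j = qbin q m j * qpoch q X (m - j) * X ^ j * qpoch q (q / (q ^ N * x)) j / qpoch q (1 / q ^ N) j" for j
  let ?K = "qpoch q (\<beta> * w) N * qpoch q \<alpha> n"
  have X0: "X \<noteq> 0" and x0: "x \<noteq> 0" using assms q0 by (simp_all add: X_def x_def)
  have v_sum: "v_sum q N \<alpha> \<beta> w m k = (\<Sum>j\<le>m. t j * (\<Sum>i\<le>j. qbin q j i * qpoch q (q / w) i * pole_frac q N \<beta> w i k * qpoch q y (j - i) * y ^ i))"
    if "k \<le> N" for k
    unfolding v_sum_def Let_def X_def[symmetric]
  proof (intro sum.cong refl)
    fix j assume "j \<in> {..m}"
    then have "qpoch q (q / (w * q ^ (N - k))) j \<noteq> 0"
      using qpoch_nonzero_le[OF nzw[OF that]] by simp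
    from pole_frac_expansion[OF that assms(3,5) this]
    show "qbin q m j * qpoch q X (m - j) * X ^ j *
       qpoch q (q / (q ^ N * \<alpha> * w)) j * qpoch q (q / (q ^ N * \<beta> * w)) j * qpoch q (1 / q ^ (N - k)) j /
       (qpoch q (1 / q ^ N) j * qpoch q (q / (w * q ^ (N - k))) j) =
       t j * (\<Sum>i\<le>j. qbin q j i * qpoch q (q / w) i * pole_frac q N \<beta> w i k * qpoch q y (j - i) * y ^ i)"
      unfolding y_def t_def x_def by (metis (no_types) mult.assoc times_divide_times_eq)
  qed
  \<comment> \<open>The coefficient \<open>(q/w)_i\<close> of the expansion cancels the denominator
    of the pairing, which leaves \<open>h\<close>.\<close>
  have pair: "(\<Sum>k\<le>N. saal_weight q N \<alpha> \<beta> w k * u_sum q N \<alpha> \<beta> w n k * pole_frac q N \<beta> w i k) * qpoch q (q / w) i = ?K * h i"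
    if "i \<le> m" for i
  proof -
    have nz: "qpoch q (q / (w * q ^ (N - k))) i \<noteq> 0" if "k \<le> N" for k
      using qpoch_nonzero_le[OF nzw[OF that] \<open>i \<le> m\<close>] .
    then have "qpoch q (q / w) i \<noteq> 0" using nz[of N] by simp
    then show ?thesis
      by (subst pairing_pole_frac) (use assms nz nzc in \<open>simp_all add: h_def x_def\<close>)
  qed
  have "(\<Sum>k\<le>N. saal_weight q N \<alpha> \<beta> w k * u_sum q N \<alpha> \<beta> w n k * v_sum q N \<alpha> \<beta> w m k) =
     (\<Sum>k\<le>N. \<Sum>j\<le>m. \<Sum>i\<le>j. t j * (qbin q j i * qpoch q y (j - i) * y ^ i) *
       (saal_weight q N \<alpha> \<beta> w k * u_sum q N \<alpha> \<beta> w n k * pole_frac q N \<beta> w i k * qpoch q (q / w) i))"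
    by (intro sum.cong refl) (simp add: v_sum sum_distrib_left mult_ac)
  also have "\<dots> = (\<Sum>j\<le>m. \<Sum>i\<le>j. t j * (qbin q j i * qpoch q y (j - i) * y ^ i) *
       ((\<Sum>k\<le>N. saal_weight q N \<alpha> \<beta> w k * u_sum q N \<alpha> \<beta> w n k * pole_frac q N \<beta> w i k) * qpoch q (q / w) i))"
    unfolding sum_distrib_left sum_distrib_right
    by (rule trans[OF sum.swap sum.cong[OF refl sum.swap]])
  also have "\<dots> = (\<Sum>j\<le>m. ?K * (t j * (\<Sum>i\<le>j. qbin q j i * h i * qpoch q y (j - i) * y ^ i)))"
    unfolding sum_distrib_left
  proof (intro sum.cong refl)
    fix j i assume "j \<in> {..m}" "i \<in> {..j}"
    then have "i \<le> m" by simp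
    from pair[OF this] show "t j * (qbin q j i * qpoch q y (j - i) * y ^ i) *
       ((\<Sum>k\<le>N. saal_weight q N \<alpha> \<beta> w k * u_sum q N \<alpha> \<beta> w n k * pole_frac q N \<beta> w i k) * qpoch q (q / w) i) =
       ?K * (t j * (qbin q j i * h i * qpoch q y (j - i) * y ^ i))"
      by (simp only: mult_ac)
  qed
  finally have total: "(\<Sum>k\<le>N. saal_weight q N \<alpha> \<beta> w k * u_sum q N \<alpha> \<beta> w n k * v_sum q N \<alpha> \<beta> w m k) =
     ?K * (\<Sum>j\<le>m. t j * (\<Sum>i\<le>j. qbin q j i * h i * qpoch q y (j - i) * y ^ i))"
    by (simp only: sum_distrib_left)
  have low: "(\<Sum>i\<le>j. qbin q j i * h i * qpoch q y (j - i) * y ^ i) = 0" if "j < n" for j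
    by (rule sum.neutral) (use that in \<open>auto simp: h_def intro!: qpoch_neg_power_eq_0\<close>)
  \<comment> \<open>The factor independent of \<open>J\<close> and \<open>m\<close>; it is the value
    of the remaining double sum on the diagonal.\<close>
  define D where "D = (1 / \<beta>) ^ n * qpoch q x (N - n) * qpoch q (1 / q ^ n) n * qpoch q \<beta> n * qpoch q (q / (q ^ N * x)) n
       * X ^ n / qpoch q (1 / q ^ N) n"
  have high: "t (n + J) * (\<Sum>i\<le>n + J. qbin q (n + J) i * h i * qpoch q y (n + J - i) * y ^ i) =
      D * qbin q m n * (qbin q (m - n) J * qpoch q (1 / X) J * qpoch q X (m - n - J) * X ^ J)"
    if "n + J \<le> m" for J
  proof -
    have 1: "qpoch q (q / (q ^ N * x)) (n + J) * (\<Sum>i\<le>n + J. qbin q (n + J) i * h i * qpoch q y (n + J - i) * y ^ i) =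
      (1 / \<beta>) ^ n * qpoch q x (N - n) * qpoch q (1 / q ^ n) n * qpoch q \<beta> n * qpoch q (q / (q ^ N * x)) n *
      (qbin q (n + J) n * qpoch q (q / (q ^ N * \<beta> * x)) J * qpoch q (q ^ n / q ^ N) J)"
      unfolding h_def y_def using expansion_coeff_sum[of n "n + J" N x \<beta>] that assms x0 by simp
    have 2: "q / (q ^ N * \<beta> * x) = 1 / X" using q0 by (simp add: X_def x_def mult_ac)
    \<comment> \<open>The tail \<open>(q^n/q^N)_J\<close> of this denominator cancels the last
      factor in fact 1.\<close>
    have 3: "qpoch q (1 / q ^ N) (n + J) = qpoch q (1 / q ^ N) n * qpoch q (q ^ n / q ^ N) J"
      by (simp add: qpoch_add)
    have nz: "qpoch q (1 / q ^ N) n * qpoch q (q ^ n / q ^ N) J \<noteq> 0"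
      using qpoch_neg_power_nonzero[of "n + J" N] that assms(2) by (simp add: 3[symmetric])
    have 4: "qbin q m (n + J) * qbin q (n + J) n = qbin q m n * qbin q (m - n) J"
      using qbin_mult_qbin[of n "n + J" m] that by simp
    have "t (n + J) * (\<Sum>i\<le>n + J. qbin q (n + J) i * h i * qpoch q y (n + J - i) * y ^ i) =
      qbin q m (n + J) * qpoch q X (m - (n + J)) * X ^ (n + J) *
       (qpoch q (q / (q ^ N * x)) (n + J) * (\<Sum>i\<le>n + J. qbin q (n + J) i * h i * qpoch q y (n + J - i) * y ^ i)) /
       (qpoch q (1 / q ^ N) n * qpoch q (q ^ n / q ^ N) J)"
      unfolding t_def 3 by simp
    also have "\<dots> = D * (qbin q m (n + J) * qbin q (n + J) n) * (qpoch q (1 / X) J * qpoch q X (m - n - J) * X ^ J)"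
      unfolding 1 2 D_def using nz by (simp add: power_add)
    finally show ?thesis unfolding 4 by (simp only: mult_ac)
  qed
  show ?thesis
  proof (cases "n \<le> m")
    case False
    then show ?thesis unfolding total by (auto simp: low)
  next
    case True
    let ?g = "\<lambda>j. t j * (\<Sum>i\<le>j. qbin q j i * h i * qpoch q y (j - i) * y ^ i)"
    have "(\<Sum>j\<le>m. ?g j) = (\<Sum>j\<in>{n..m}. ?g j)"
      by (rule sum.mono_neutral_right) (auto simp: low)
    also have "\<dots> = (\<Sum>J\<le>m - n. ?g (n + J))"
      using sum.shift_bounds_cl_nat_ivl[of ?g 0 n "m - n"] True by (simp add: atMost_atLeast0 add.commute)
    also have "\<dots> = (\<Sum>J\<le>m - n. D * qbin q m n * (qbin q (m - n) J * qpoch q (1 / X) J * qpoch q X (m - n - J) * X ^ J))"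
      by (intro sum.cong refl high) (use True in auto)
    also have "\<dots> = D * qbin q m n * qpoch q 1 (m - n)"
      unfolding sum_distrib_left[symmetric] q_chu_vandermonde using X0 by simp
    \<comment> \<open>For \<open>m > n\<close> the product \<open>(1)_(m-n)\<close> starts with the
      factor \<open>1 - 1\<close>.\<close>
    also have "\<dots> = (if n = m then D else 0)"
      using True qbin_self by (auto intro!: qpoch_eq_0[of _ _ 0])
    also have "D = qpoch q \<beta> n * (\<alpha> * w * q ^ N / q) ^ n *
       qpoch q x (N - n) * qpoch q (q / (q ^ N * x)) n * qpoch q (1 / q ^ n) n / qpoch q (1 / q ^ N) n"
    proof -
      have "\<alpha> * w * q ^ N / q = 1 / \<beta> * X" using assms(5) by (simp add: X_def)
      then show ?thesis by (simp only: D_def power_mult_distrib) (simp add: mult_ac)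
    qed
    finally show ?thesis unfolding total by (simp add: x_def mult_ac)
  qed
qed

text \<open>Reverse the last \<open>n\<close> factors of \<open>(x)_N\<close> and all of
  \<open>(q)_n\<close>. The two triangular powers of \<open>q\<close> combine through
  \<open>n(n-1) + n = n^2\<close>. This brings the diagonal value, with \<open>x = e\<close>, to the
  shape of the stated constant.\<close>

lemma norm_const_eq:
  assumes "n \<le> N" "x \<noteq> 0"
  shows "(x * q ^ N / q) ^ n * qpoch q x (N - n) * qpoch q (q / (q ^ N * x)) n * qpoch q (1 / q ^ n) n =
    qpoch q x N * qpoch q q n / q ^ n"
proof -
  define C where "C = q ^ (\<Sum>j<n. j)"
  have C: "C * C * q ^ n = q ^ (n * n)"
  proof -
    have "(\<Sum>j<n. j) + (\<Sum>j<n. j) + n = n * n" by (induction n) auto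
    then show ?thesis by (simp add: C_def flip: power_add)
  qed
  have "qpoch q (x * q ^ (N - n)) n = (- (x * q ^ (N - n))) ^ n * C * qpoch q (q / (q ^ N * x)) n"
    unfolding C_def
    by (rule qpoch_reflect) (use q0 assms in \<open>simp_all add: field_simps flip: power_add\<close>)
  then have 1: "qpoch q x N = qpoch q x (N - n) * ((- (x * q ^ (N - n))) ^ n * C * qpoch q (q / (q ^ N * x)) n)"
    using qpoch_add[of q x "N - n" n] assms(1) by simp
  have 2: "qpoch q q n = (- q) ^ n * C * qpoch q (1 / q ^ n) n"
    using qpoch_neg_power[of n n] by (simp add: C_def)
  have "(x * q ^ N / q) ^ n = (- (x * q ^ (N - n))) ^ n * C * ((- q) ^ n * C) / q ^ n"
  proof -
    have "(- (x * q ^ (N - n))) ^ n * C * ((- q) ^ n * C) * q ^ n = (x * q ^ (N - n) * q) ^ n * (C * C * q ^ n)"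
      by (simp add: power_mult_distrib[symmetric] mult_ac)
    also have "\<dots> = (x * q ^ (N - n) * q * q ^ n) ^ n"
      unfolding C by (simp add: power_mult power_mult_distrib)
    also have "x * q ^ (N - n) * q * q ^ n = x * q ^ N * q"
      using assms(1) by (simp add: mult_ac flip: power_add)
    finally show ?thesis using q0 by (simp add: field_simps power_mult_distrib power_divide)
  qed
  then show ?thesis unfolding 1 2 by (simp only: mult_ac times_divide_eq_left times_divide_eq_right)
qed

end

section \<open>Translation to the original parameters\<close>

lemma qpochs_simps [simp]:
  "qpochs q [] k = 1" "qpochs q (x # xs) k = qpoch q x k * qpochs q xs k"
  by (simp_all add: qpochs_def)

context
  fixes q a b d e \<alpha> \<beta> w :: complex
  assumes q0: "q \<noteq> 0" and qq0: "\<And>n. qpoch q q n \<noteq> 0"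
    and nz: "a \<noteq> 0" "b \<noteq> 0" "d \<noteq> 0" "e \<noteq> 0"
    and \<alpha>: "\<alpha> = a * q / d" and \<beta>: "\<beta> = a * q / e" and w: "w = d * e / (a * q)"
begin

lemma param_simps: "\<alpha> * w = e" "\<beta> * w = d" "\<alpha> * \<beta> * w = a * q" "1 / w = a * q / (d * e)" "w \<noteq> 0" "\<alpha> \<noteq> 0" "\<beta> \<noteq> 0"
  using q0 nz by (simp_all add: \<alpha> \<beta> w)

lemma powi_simps:
  "q powi (- int n) = 1 / q ^ n" "q powi (1 - int n) = q / q ^ n" "q powi (2 - int n) = q * q / q ^ n"
  "q powi (1 - int n - int m) = q / (q ^ n * q ^ m)"
  using q0 by (simp_all add: power_int_diff power_int_minus power_int_add field_simps power2_eq_square)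

text \<open>All three rest on \<open>2 x_k / b = q^k\<close>.\<close>

lemma node_simps:
  "k \<le> N \<Longrightarrow> 2 * node q b k * q powi (- int N) / b = 1 / q ^ (N - k)"
  "2 * a * q * node q b k / b = \<alpha> * \<beta> * w * q ^ k"
  "k \<le> N \<Longrightarrow> 2 * a * node q b k * q powi (2 - int N) / (b * d * e) = q / (w * q ^ (N - k))"
  using q0 nz unfolding param_simps
  by (simp_all add: node_def powi_simps w field_simps flip: power_add)

text \<open>Termwise \<open>qbin_reversed\<close> with \<open>y = 1/w\<close>, which absorbs the
  prefactor \<open>(aq/(de))_n = (1/w)_n\<close>.\<close>

lemma U_eq_u_sum:
  assumes "k \<le> N" and nzw: "\<And>j. j \<le> n \<Longrightarrow> qpoch q (d * e * q powi (- int n) / a) j \<noteq> 0"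
  shows "U q N a b d e n (node q b k) =
    qpoch q (a * q) n / (qpoch q \<alpha> n * qpoch q \<beta> n) * u_sum q N \<alpha> \<beta> w n k"
proof -
  have y: "d * e * q powi (- int n) / a = q / (q ^ n * (1 / w))"
    using q0 nz by (simp add: powi_simps w)
  have "qpoch q (1 / w) n * phi43 q (1 / q ^ (N - k)) d e n (\<alpha> * \<beta> * w * q ^ k) (1 / q ^ N) (q / (q ^ n * (1 / w))) =
      u_sum q N \<alpha> \<beta> w n k"
    unfolding phi43_def u_sum_def sum_distrib_left atMost_atLeast0
  proof (intro sum.cong refl)
    fix j assume "j \<in> {0..n}"
    then have "j \<le> n" by simp
    from qbin_reversed[OF q0 qq0 this, of "1 / w"] nzw[OF this] param_simps(5)
    have *: "qbin q n j * qpoch q (1 / w) (n - j) * (1 / w) ^ j =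
        qpoch q (1 / w) n * qpoch q (1 / q ^ n) j / (qpoch q (q / (q ^ n * (1 / w))) j * qpoch q q j) * q ^ j"
      unfolding y by simp
    show "qpoch q (1 / w) n * (qpochs q [1 / q ^ (N - k), d, e, q powi (- int n)] j /
       qpochs q [\<alpha> * \<beta> * w * q ^ k, 1 / q ^ N, q / (q ^ n * (1 / w)), q] j * q ^ j) =
       qbin q n j * qpoch q (\<alpha> * w) j * qpoch q (\<beta> * w) j *
       qpoch q (1 / w) (n - j) * (1 / w) ^ j * u_basis q N (\<alpha> * \<beta> * w) j k"
    proof -
      have "qbin q n j * qpoch q (\<alpha> * w) j * qpoch q (\<beta> * w) j *
         qpoch q (1 / w) (n - j) * (1 / w) ^ j * u_basis q N (\<alpha> * \<beta> * w) j k =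
         (qbin q n j * qpoch q (1 / w) (n - j) * (1 / w) ^ j) *
         (qpoch q e j * qpoch q d j * u_basis q N (\<alpha> * \<beta> * w) j k)"
        unfolding param_simps(1,2) by (simp only: mult_ac)
      then show ?thesis unfolding * u_basis_def by (simp add: powi_simps mult_ac)
    qed
  qed
  then show ?thesis
    unfolding U_def y node_simps(1)[OF assms(1)] node_simps(2) param_simps(4)[symmetric]
    by (simp add: powi_simps \<alpha>[symmetric] \<beta>[symmetric])
qed

text \<open>Termwise \<open>qbin_reversed\<close> with \<open>y = X = a q^N\<close>, which absorbs
  the prefactor \<open>(a q^N)_m\<close>; the other prefactor \<open>(a q^(2-N)/(de))_m\<close>
  stays outside.\<close>

lemma V_eq_v_sum:
  assumes "k \<le> N" and nzX: "\<And>j. j \<le> m \<Longrightarrow> qpoch q (q powi (1 - int N - int m) / a) j \<noteq> 0"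
  shows "V q N a b d e m (node q b k) =
    qpoch q (q / (q ^ N * w)) m / (qpoch q \<alpha> m * qpoch q \<beta> m) * v_sum q N \<alpha> \<beta> w m k"
proof -
  define X where "X = \<alpha> * \<beta> * w * q ^ N / q"
  have X: "X = a * q ^ N" using q0 by (simp add: X_def param_simps)
  have X0: "X \<noteq> 0" using q0 nz by (simp add: X)
  have y: "q powi (1 - int N - int m) / a = q / (q ^ m * X)"
    using q0 nz by (simp add: powi_simps X mult_ac)
  have de: "q powi (1 - int N) / d = q / (q ^ N * \<beta> * w)" "q powi (1 - int N) / e = q / (q ^ N * \<alpha> * w)"
    by (simp_all add: powi_simps param_simps mult.assoc)
  have A: "a * q powi (2 - int N) / (d * e) = q / (q ^ N * w)"
    using q0 nz by (simp add: powi_simps w)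
  have "qpoch q X m * phi43 q (1 / q ^ (N - k)) (q / (q ^ N * \<beta> * w)) (q / (q ^ N * \<alpha> * w)) m
       (q / (w * q ^ (N - k))) (1 / q ^ N) (q / (q ^ m * X)) = v_sum q N \<alpha> \<beta> w m k"
    unfolding phi43_def v_sum_def sum_distrib_left atMost_atLeast0 Let_def X_def[symmetric]
  proof (intro sum.cong refl)
    fix j assume "j \<in> {0..m}"
    then have "j \<le> m" by simp
    from qbin_reversed[OF q0 qq0 this X0] nzX[OF this]
    have *: "qbin q m j * qpoch q X (m - j) * X ^ j =
        qpoch q X m * qpoch q (1 / q ^ m) j / (qpoch q (q / (q ^ m * X)) j * qpoch q q j) * q ^ j"
      unfolding y by simp
    show "qpoch q X m * (qpochs q [1 / q ^ (N - k), q / (q ^ N * \<beta> * w), q / (q ^ N * \<alpha> * w), q powi (- int m)] j /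
       qpochs q [q / (w * q ^ (N - k)), 1 / q ^ N, q / (q ^ m * X), q] j * q ^ j) =
       qbin q m j * qpoch q X (m - j) * X ^ j *
       qpoch q (q / (q ^ N * \<alpha> * w)) j * qpoch q (q / (q ^ N * \<beta> * w)) j * qpoch q (1 / q ^ (N - k)) j /
       (qpoch q (1 / q ^ N) j * qpoch q (q / (w * q ^ (N - k))) j)"
      unfolding * by (simp add: powi_simps mult_ac)
  qed
  then show ?thesis
    unfolding V_def y de A node_simps(1)[OF assms(1)] node_simps(3)[OF assms(1)] X[symmetric]
    by (simp add: powi_simps \<alpha>[symmetric] \<beta>[symmetric] mult.commute)
qed

text \<open>Here \<open>qbin_reversed\<close> is applied with \<open>y = w\<close> and order
  \<open>N\<close> to absorb \<open>(de/(aq))_N\<close>, while \<open>(aq)_N / (aq)_k\<close>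
  becomes \<open>(aq q^k)_(N-k)\<close>.\<close>

lemma weight_eq_saal_weight:
  assumes "k \<le> N" and nzA: "qpoch q (a * q powi (2 - int N) / (d * e)) k \<noteq> 0" and nzc: "qpoch q (a * q) k \<noteq> 0"
  shows "weight q N a d e k = saal_weight q N \<alpha> \<beta> w k / (qpoch q d N * qpoch q e N)"
proof -
  have A: "a * q powi (2 - int N) / (d * e) = q / (q ^ N * w)"
    using q0 nz by (simp add: powi_simps w)
  have 1: "qbin q N k * qpoch q w (N - k) * w ^ k =
      qpoch q w N * qpoch q (1 / q ^ N) k / (qpoch q (q / (q ^ N * w)) k * qpoch q q k) * q ^ k"
    using qbin_reversed[OF q0 qq0 assms(1) param_simps(5)] nzA by (simp add: A)
  have 2: "qpoch q (a * q) N = qpoch q (a * q) k * qpoch q (a * q * q ^ k) (N - k)"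
    using qpoch_add[of q "a * q" k "N - k"] assms(1) by simp
  have "saal_weight q N \<alpha> \<beta> w k = qpoch q \<alpha> k * qpoch q \<beta> k * qpoch q (a * q * q ^ k) (N - k) *
      (qbin q N k * qpoch q w (N - k) * w ^ k)"
    unfolding saal_weight_def param_simps(3) by (simp only: mult_ac)
  then show ?thesis
    unfolding weight_def A 1 using nzc by (simp add: 2 powi_simps mult_ac flip: \<alpha> \<beta> w)
qed

end

section \<open>The biorthogonality relation\<close>

theorem corollary4p2:
  fixes q a b d e :: complex and N :: nat
  assumes "0 < norm q" and "norm q < 1"
    and "a \<noteq> 0" and "b \<noteq> 0" and "d \<noteq> 0" and "e \<noteq> 0"
    and "no_zero_denominators q N a b d e"
  shows "\<forall>n\<le>N. \<forall>m\<le>N.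
    (\<Sum>k=0..N. U q N a b d e n (node q b k) * V q N a b d e m (node q b k) * weight q N a d e k) =
    (if n = m then norm_const q N a d e n else 0)"
proof (intro allI impI)
  fix n m assume nm: "n \<le> N" "m \<le> N"
  have q0: "q \<noteq> 0" using assms(1) by auto
  note qq0 = qpoch_self_nonzero[OF assms(2)]
  define \<alpha> \<beta> w where pd: "\<alpha> = a * q / d" "\<beta> = a * q / e" "w = d * e / (a * q)"
  note ctx = q0 qq0 assms(3-6) pd
  note ps = param_simps[OF ctx] and ws = powi_simps[OF ctx] and ns = node_simps[OF ctx]
  note nzd = assms(7)[unfolded no_zero_denominators_def]
  have nz1: "qpoch q \<alpha> k \<noteq> 0" "qpoch q \<beta> k \<noteq> 0" if "k \<le> N" for k
    using nzd that by (simp_all add: pd)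
  have nz2: "qpoch q (\<alpha> * \<beta> * w * q ^ k) j \<noteq> 0" "qpoch q (d * e * q powi (- int i) / a) j \<noteq> 0"
    if "k \<le> N" "i \<le> N" "j \<le> i" for k i j
    using nzd that by (auto simp: ns(2))
  have nz3: "qpoch q (q / (w * q ^ (N - k))) j \<noteq> 0" "qpoch q (q powi (1 - int N - int i) / a) j \<noteq> 0"
    if "k \<le> N" "i \<le> N" "j \<le> i" for k i j
    using nzd that by (auto simp: ns(3)[OF that(1)])
  have nz4: "qpoch q (a * q) k \<noteq> 0" "qpoch q (a * q powi (2 - int N) / (d * e)) k \<noteq> 0" if "k \<le> N" for k
    using nzd that by simp_all
  have nz5: "qpoch q d N \<noteq> 0" "qpoch q e N \<noteq> 0" using nzd by simp_all
  \<comment> \<open>The product of the prefactors of \<open>U\<close>, \<open>V\<close> and the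
    weight, all independent of the node.\<close>
  define K where "K = qpoch q (a * q) n * qpoch q (q / (q ^ N * w)) m /
      (qpoch q \<alpha> n * qpoch q \<beta> n * (qpoch q \<alpha> m * qpoch q \<beta> m) * (qpoch q d N * qpoch q e N))"
  have "(\<Sum>k=0..N. U q N a b d e n (node q b k) * V q N a b d e m (node q b k) * weight q N a d e k) =
     (\<Sum>k\<le>N. K * (saal_weight q N \<alpha> \<beta> w k * u_sum q N \<alpha> \<beta> w n k * v_sum q N \<alpha> \<beta> w m k))"
    unfolding atMost_atLeast0
  proof (intro sum.cong refl)
    fix k assume "k \<in> {0..N}"
    then have k: "k \<le> N" by simp
    show "U q N a b d e n (node q b k) * V q N a b d e m (node q b k) * weight q N a d e k =
        K * (saal_weight q N \<alpha> \<beta> w k * u_sum q N \<alpha> \<beta> w n k * v_sum q N \<alpha> \<beta> w m k)"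
      using U_eq_u_sum[OF ctx k] V_eq_v_sum[OF ctx k] weight_eq_saal_weight[OF ctx k]
        nz2(2)[OF k nm(1)] nz3(2)[OF k nm(2)] nz4[OF k]
      by (simp add: K_def mult_ac)
  qed
  also have "\<dots> = K * (if n = m then qpoch q d N * qpoch q \<alpha> n * qpoch q \<beta> n * ((e * q ^ N / q) ^ n *
       qpoch q e (N - n) * qpoch q (q / (q ^ N * e)) n * qpoch q (1 / q ^ n) n) / qpoch q (1 / q ^ N) n
     else 0)"
    unfolding sum_distrib_left[symmetric]
    by (subst pairing_u_sum_v_sum[OF q0 qq0 nm ps(5-7)])
       (use nz2(1)[OF _ nm(1) order_refl] nz3(1)[OF _ nm(2) order_refl] in \<open>simp_all add: ps(1,2) mult_ac\<close>)
  also have "\<dots> = (if n = m then norm_const q N a d e n else 0)"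
  proof (cases "n = m")
    case True
    have A: "a * q powi (2 - int N) / (d * e) = q / (q ^ N * w)"
      using q0 assms(3-6) by (simp add: ws pd)
    show ?thesis
      \<comment> \<open>The resulting \<open>(e)_N\<close> and the factor
        \<open>(d)_N = (\<beta> w)_N\<close> cancel the denominators of the weight; for
        \<open>m = n\<close> one copy of \<open>(\<alpha>, \<beta>)_n\<close> cancels as
        well.\<close>
      unfolding norm_const_eq[OF q0 qq0 nm(1) assms(6)] norm_const_def A
      using True nz1[OF nm(1)] nz5 by (simp add: K_def ws mult_ac flip: pd)
  qed simp
  finally show "(\<Sum>k=0..N. U q N a b d e n (node q b k) * V q N a b d e m (node q b k) * weight q N a d e k) =
    (if n = m then norm_const q N a d e n else 0)" .
qed

end
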